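(* Let $n\ge 1$, let $p_1,\dots,p_n$ be real polynomials and $q_1,\dots,q_n$ real second order polynomials such that the functions $h_j(x)=p_j(x)e^{q_j(x)}$, $j=1,\dots,n$, are linearly independent, and let $f=\sum_{j=1}^n h_j$. For $1\le m\le n$ let $W_m=W(h_1,\dots,h_m)$ be the Wronskian, and let $W_0=1$. Then for every $1\le m\le n$ there is a polynomial $P_m\not\equiv 0$ with $$W_m(x)=P_m(x)\,e^{\sum_{j=1}^m q_j(x)}.$$ Moreover, the functions defined by $$\psi_0=f,\qquad \psi_j=\frac{W_j}{W_{j-1}}\,D\left(\frac{W_{j-1}}{W_j}\,\psi_{j-1}\right),\qquad j=1,\dots,n,$$ satisfy $\psi_n\equiv 0$, and $\psi_0,\psi_1,\dots,\psi_n$ is a Generalized Budan-Fourier sequence for $f$ on any closed bounded interval $[a,b]$, with associated pivots $\varrho_k=W_k/W_{k-1}$, $k=1,\dots,n$.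
   Context: $D$ denotes differentiation with respect to $x$. The Wronskian $W(h_1,\dots,h_m)$ is the determinant of the $m\times m$ matrix whose $(i,j)$ entry is $D^{i-1}h_j$. Generalized Budan-Fourier (GBF) sequence: a sequence of functions $\{\psi_i,\ i=0,\dots,n\}$ is a GBF sequence associated to the real analytic function $f$ on $[a,b]$, with associated sequence of pivots $\{\varrho_i,\ i=1,\dots,n\}$, if (i) $\psi_0=f$; (ii) $\psi_i$ and $\varrho_i$ are quotients of real analytic functions on $[a,b]$ for each $i=1,\dots,n$; (iii) $\psi_n$ is the zero function; (iv) for each $k=1,\dots,n$, $D\left(\frac{\psi_{k-1}}{\varrho_k}\right)=\frac{\psi_k}{\varrho_k}$ for every $x$ for which both sides are defined. Quotients of real analytic functions are regarded as meromorphic functions, and equalities between them are understood wherever both sides are defined. *)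

theory Defs
  imports
    "HOL-Analysis.Analysis"
    "HOL-Computational_Algebra.Polynomial"
    "Jordan_Normal_Form.Determinant"
begin

text \<open>
  Two-sided local power series at every point of \<open>S\<close>; for \<open>S = {a..b}\<close> this is analyticity on a
  neighbourhood of the closed interval.
\<close>
definition real_analytic_on :: "(real \<Rightarrow> real) \<Rightarrow> real set \<Rightarrow> bool" where
  "real_analytic_on f S \<longleftrightarrow> (\<forall>x\<in>S. \<exists>F. (\<lambda>t. f (x + t)) has_fps_expansion F)"

text \<open>
  A meromorphic function is represented by a total function on the reals whose values at the (isolated)
  singularities carry no meaning. It is defined at \<open>x\<close> if the singularity at \<open>x\<close> is
  removable, and its value there is then the limit. The function \<open>mero_val\<close> is the real counterpart of
  \<open>remove_sings\<close> from \<open>HOL-Complex_Analysis\<close>, including the value 0 at poles.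
\<close>
definition mero_defined_at :: "(real \<Rightarrow> real) \<Rightarrow> real \<Rightarrow> bool" where
  "mero_defined_at \<phi> x \<longleftrightarrow> (\<exists>L. \<phi> \<midarrow>x\<rightarrow> L)"

definition mero_val :: "(real \<Rightarrow> real) \<Rightarrow> real \<Rightarrow> real" where
  "mero_val \<phi> x = (if mero_defined_at \<phi> x then Lim (at x) \<phi> else 0)"

text \<open>
  Equality with \<open>g / h\<close> is required on a neighbourhood of the interval, away from the zeros of the
  denominator, because \<open>deriv\<close> is two-sided also at the end points.
\<close>
definition analytic_quotient_on :: "(real \<Rightarrow> real) \<Rightarrow> real \<Rightarrow> real \<Rightarrow> bool" where
  "analytic_quotient_on \<phi> a b \<longleftrightarrow>
     (\<exists>g h. real_analytic_on g {a..b} \<and> real_analytic_on h {a..b} \<and>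
        (\<exists>x\<in>{a..b}. h x \<noteq> 0) \<and>
        (\<forall>c\<in>{a..b}. \<forall>\<^sub>F x in nhds c. h x \<noteq> 0 \<longrightarrow> \<phi> x = g x / h x))"

text \<open>
  The pivots are divisors, so they must not be the zero meromorphic function. This has to be said
  explicitly because division by 0 is total here.
\<close>
definition GBF_sequence ::
  "(real \<Rightarrow> real) \<Rightarrow> real \<Rightarrow> real \<Rightarrow> nat \<Rightarrow> (nat \<Rightarrow> real \<Rightarrow> real) \<Rightarrow> (nat \<Rightarrow> real \<Rightarrow> real) \<Rightarrow> bool" where
  "GBF_sequence f a b n \<psi> \<rho> \<longleftrightarrow>
     real_analytic_on f {a..b} \<and>
     (\<forall>x\<in>{a..b}. \<psi> 0 x = f x) \<and>
     (\<forall>i\<in>{1..n}. analytic_quotient_on (\<psi> i) a b \<and> analytic_quotient_on (\<rho> i) a b \<and>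
        (\<exists>x\<in>{a..b}. mero_val (\<rho> i) x \<noteq> 0)) \<and>
     (\<forall>x\<in>{a..b}. \<psi> n x = 0) \<and>
     (\<forall>k\<in>{1..n}. \<forall>x\<in>{a..b}.
        mero_defined_at (deriv (\<lambda>t. \<psi> (k - 1) t / \<rho> k t)) x \<longrightarrow>
        mero_defined_at (\<lambda>t. \<psi> k t / \<rho> k t) x \<longrightarrow>
        mero_val (deriv (\<lambda>t. \<psi> (k - 1) t / \<rho> k t)) x = mero_val (\<lambda>t. \<psi> k t / \<rho> k t) x)"

text \<open>
  The Wronskian of \<open>h 1, \<dots>, h m\<close>; matrix indices start at 0. The determinant is qualified because
  \<open>HOL-Analysis\<close> has another constant \<open>det\<close>.
\<close>
definition wronskian :: "(nat \<Rightarrow> real \<Rightarrow> real) \<Rightarrow> nat \<Rightarrow> real \<Rightarrow> real" where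
  "wronskian h m x =
     Determinant.det (Matrix.mat m m (\<lambda>(i, j). (deriv ^^ i) (h (Suc j)) x))"

lemma wronskian_0: "wronskian h 0 x = 1"
  by (simp add: wronskian_def)

definition lin_indep_functions :: "(nat \<Rightarrow> real \<Rightarrow> real) \<Rightarrow> nat \<Rightarrow> bool" where
  "lin_indep_functions h n \<longleftrightarrow>
     (\<forall>c :: nat \<Rightarrow> real. (\<forall>x. (\<Sum>j=1..n. c j * h j x) = 0) \<longrightarrow> (\<forall>j\<in>{1..n}. c j = 0))"

text \<open>
  Each member is taken with its removable singularities filled in, so that pointwise
  statements about it are statements about the meromorphic function.
\<close>
primrec wronskian_chain ::
  "(nat \<Rightarrow> real \<Rightarrow> real) \<Rightarrow> (real \<Rightarrow> real) \<Rightarrow> nat \<Rightarrow> real \<Rightarrow> real" where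
  "wronskian_chain h f 0 = f"
| "wronskian_chain h f (Suc j) =
     mero_val (\<lambda>x. wronskian h (Suc j) x / wronskian h j x *
       deriv (\<lambda>t. wronskian h j t / wronskian h (Suc j) t * wronskian_chain h f j t) x)"

end

(*
  Each step of the chain is the first order operator D - rho_j'/rho_j, so psi_j = L_j f for a monic
  operator L_j of order j that is linear in f.  Inductively L_j annihilates h_1, ..., h_j: replacing
  the last row of the matrix of W_{j+1} by its L_j-combination gives W_{j+1} = W_j * L_j h_{j+1},
  so L_j h_{j+1} is the next pivot rho_{j+1} and is annihilated by step j+1.  Hence L_n f = 0.
  Conversely, on an interval without zeros of the Wronskians the kernel of L_j is spanned by
  h_1, ..., h_j, so W_{j+1} = 0 would make h_1, ..., h_{j+1} dependent there, and therefore
  everywhere by the identity theorem applied to their entire extensions.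
*)
theory Submission
  imports Defs "HOL-Complex_Analysis.Complex_Analysis"
begin

section \<open>The chain on the polynomial factors\<close>

text \<open>\<open>D (u e^r) = (twisted_pderiv r u) e^r\<close>, so differentiation of such products
  becomes an operator on polynomials.\<close>

definition twisted_pderiv :: "real poly \<Rightarrow> real poly \<Rightarrow> real poly" where
  "twisted_pderiv r u = pderiv u + pderiv r * u"

text \<open>What remains of \<open>W_m\<close> once the factor \<open>e^(q_j)\<close> is pulled out
  of column \<open>j\<close>.\<close>

definition wronskian_poly :: "(nat \<Rightarrow> real poly) \<Rightarrow> (nat \<Rightarrow> real poly) \<Rightarrow> nat \<Rightarrow> real poly" where
  "wronskian_poly p q m =
     Determinant.det (Matrix.mat m m (\<lambda>(i, j). (twisted_pderiv (q (Suc j)) ^^ i) (p (Suc j))))"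

text \<open>A common multiple of the polynomial parts up to \<open>m\<close>: it clears the
  denominators of the chain, and off its roots all these Wronskians are nonzero.\<close>

definition wronskian_poly_prod :: "(nat \<Rightarrow> real poly) \<Rightarrow> (nat \<Rightarrow> real poly) \<Rightarrow> nat \<Rightarrow> real poly" where
  "wronskian_poly_prod p q m = (\<Prod>k=1..m. wronskian_poly p q k)"

text \<open>
  On functions, the \<open>j\<close>-th step of the chain is \<open>D - \<rho>'/\<rho>\<close> with \<open>\<rho> = W\<^sub>j / W\<^sub>j\<^sub>-\<^sub>1\<close>. With \<open>Q\<close> the product
  of the polynomial parts of all \<open>W\<^sub>k\<close>, the operator \<open>chain_poly j\<close> is \<open>Q\<^sup>j\<close> times the composite of the
  first \<open>j\<close> steps, so that it acts on polynomials; the summand \<open>j Q'\<close> below comes from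
  differentiating \<open>Q\<^sup>-\<^sup>j\<close>. Indices are shifted: \<open>chain_coeff j\<close> belongs to step \<open>j + 1\<close>.
\<close>
definition chain_coeff :: "(nat \<Rightarrow> real poly) \<Rightarrow> (nat \<Rightarrow> real poly) \<Rightarrow> nat \<Rightarrow> nat \<Rightarrow> real poly" where
  "chain_coeff p q m j = (let Q = wronskian_poly_prod p q m; W = wronskian_poly p q in
     of_nat j * pderiv Q + (Q div W (Suc j)) * pderiv (W (Suc j))
     - (Q div W j) * pderiv (W j) + pderiv (q (Suc j)) * Q)"

primrec chain_poly ::
  "(nat \<Rightarrow> real poly) \<Rightarrow> (nat \<Rightarrow> real poly) \<Rightarrow> nat \<Rightarrow> nat \<Rightarrow> real poly \<Rightarrow> real poly \<Rightarrow> real poly" where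
  "chain_poly p q m 0 r u = u"
| "chain_poly p q m (Suc j) r u =
     wronskian_poly_prod p q m * twisted_pderiv r (chain_poly p q m j r u)
     - chain_coeff p q m j * chain_poly p q m j r u"

section \<open>Linearity of the chain operators and their expansion in derivatives\<close>

lemma wronskian_poly_0 [simp]: "wronskian_poly p q 0 = 1"
  by (simp add: wronskian_poly_def)

lemma twisted_pderiv_sum: "twisted_pderiv r (\<Sum>i\<in>A. g i) = (\<Sum>i\<in>A. twisted_pderiv r (g i))"
  by (induction A rule: infinite_finite_induct)
    (auto simp: twisted_pderiv_def pderiv_add algebra_simps)

lemma twisted_pderiv_mult: "twisted_pderiv r (a * u) = pderiv a * u + a * twisted_pderiv r u"
  by (simp add: twisted_pderiv_def pderiv_mult algebra_simps)

lemma chain_poly_diff: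
  "chain_poly p q m j r (u - v) = chain_poly p q m j r u - chain_poly p q m j r v"
proof (induction j)
  case (Suc j)
  have tw: "twisted_pderiv r (w - z) = twisted_pderiv r w - twisted_pderiv r z" for w z
    by (simp add: twisted_pderiv_def pderiv_diff algebra_simps)
  show ?case by (simp only: chain_poly.simps Suc tw) (simp add: algebra_simps)
qed simp

lemma chain_poly_const_mult:
  "chain_poly p q m j r ([:c:] * u) = [:c:] * chain_poly p q m j r u"
proof (induction j)
  case (Suc j)
  have "twisted_pderiv r ([:c:] * w) = [:c:] * twisted_pderiv r w" for w
    by (simp add: twisted_pderiv_mult pderiv_pCons del: mult_pCons_left)
  with Suc show ?case by (simp only: chain_poly.simps) (simp add: algebra_simps del: mult_pCons_left mult_pCons_right)
qed simp

lemma chain_poly_0_right: "chain_poly p q m j r 0 = 0"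
  by (induction j) (simp_all add: twisted_pderiv_def)

text \<open>
  The coefficients do not depend on \<open>r\<close>: hence on the rows of the Wronskian matrix, where each column
  has its own exponent, the operator is a row operation.
\<close>
lemma chain_poly_expand:
  "\<exists>a. a j = wronskian_poly_prod p q m ^ j \<and>
     (\<forall>r u. chain_poly p q m j r u = (\<Sum>i\<le>j. a i * (twisted_pderiv r ^^ i) u))"
proof (induction j)
  case 0
  show ?case by (intro exI[of _ "\<lambda>_. 1"]) simp
next
  case (Suc j)
  then obtain a where a: "a j = wronskian_poly_prod p q m ^ j"
    "\<And>r u. chain_poly p q m j r u = (\<Sum>i\<le>j. a i * (twisted_pderiv r ^^ i) u)" by blast
  define Q s where "Q = wronskian_poly_prod p q m" and "s = chain_coeff p q m j"
  \<comment> \<open>The product rule either differentiates \<open>a i\<close> (first summand,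
    together with \<open>- s\<close>) or raises the order of the derivative by one (second summand,
    hence the shift). At \<open>Suc j\<close> only the second survives and gives the leading
    coefficient.\<close>
  define b where "b i = (if i \<le> j then Q * pderiv (a i) - s * a i else 0)
    + (if i = 0 then 0 else Q * a (i - 1))" for i
  have "chain_poly p q m (Suc j) r u = (\<Sum>i\<le>Suc j. b i * (twisted_pderiv r ^^ i) u)" for r u
  proof -
    let ?e = "\<lambda>i. (twisted_pderiv r ^^ i) u"
    have "chain_poly p q m (Suc j) r u
        = (\<Sum>i\<le>j. (Q * pderiv (a i) - s * a i) * ?e i) + (\<Sum>i\<le>j. Q * a i * ?e (Suc i))"
      by (simp add: a Q_def s_def twisted_pderiv_sum twisted_pderiv_mult sum_distrib_left
          algebra_simps sum.distrib sum_subtractf)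
    also have "(\<Sum>i\<le>j. (Q * pderiv (a i) - s * a i) * ?e i)
        = (\<Sum>i\<le>Suc j. (if i \<le> j then Q * pderiv (a i) - s * a i else 0) * ?e i)"
      by simp
    also have "(\<Sum>i\<le>j. Q * a i * ?e (Suc i))
        = (\<Sum>i\<le>Suc j. (if i = 0 then 0 else Q * a (i - 1)) * ?e i)"
      by (subst sum.atMost_Suc_shift) simp
    finally show ?thesis
      by (simp only: b_def distrib_right sum.distrib)
  qed
  moreover have "b (Suc j) = Q ^ Suc j" by (simp add: b_def a Q_def)
  ultimately show ?case unfolding Q_def by blast
qed

text \<open>Replacing the last row by the combination with coefficients \<open>a\<close> is left
  multiplication by the lower triangular \<open>B\<close>, of determinant \<open>a j\<close>. The
  new last row vanishes except in its last entry.\<close>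

lemma det_replace_last_row:
  fixes e :: "nat \<Rightarrow> nat \<Rightarrow> 'a :: comm_ring_1"
  assumes "\<And>k. k < j \<Longrightarrow> (\<Sum>i\<le>j. a i * e i k) = 0"
  shows "a j * Determinant.det (Matrix.mat (Suc j) (Suc j) (\<lambda>(i, k). e i k))
    = (\<Sum>i\<le>j. a i * e i j) * Determinant.det (Matrix.mat j j (\<lambda>(i, k). e i k))"
proof -
  define A where "A = Matrix.mat (Suc j) (Suc j) (\<lambda>(i, k). e i k)"
  define B where "B = Matrix.mat (Suc j) (Suc j)
    (\<lambda>(r, i). if r < j then (if i = r then 1 else 0) else a i)"
  define M where "M = Matrix.mat (Suc j) (Suc j)
    (\<lambda>(r, k). if r < j then e r k else (\<Sum>i\<le>j. a i * e i k))"
  have A: "A \<in> carrier_mat (Suc j) (Suc j)" and B: "B \<in> carrier_mat (Suc j) (Suc j)"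
    and M: "M \<in> carrier_mat (Suc j) (Suc j)"
    by (simp_all add: A_def B_def M_def)
  have "B * A = M"
  proof (rule eq_matI)
    fix r k assume rk: "r < dim_row M" "k < dim_col M"
    then have "(B * A) $$ (r, k) = (\<Sum>i<Suc j. B $$ (r, i) * A $$ (i, k))"
      using A B M by (simp add: times_mat_def scalar_prod_def atLeast0LessThan)
    also have "\<dots> = (\<Sum>i<Suc j. (if r < j then (if i = r then 1 else 0) else a i) * e i k)"
      using rk by (intro sum.cong) (auto simp: A_def B_def M_def)
    also have "\<dots> = (if r < j then e r k else (\<Sum>i\<le>j. a i * e i k))"
    proof (cases "r < j")
      case True
      then have "(\<Sum>i<Suc j. (if i = r then 1 else 0) * e i k) = (\<Sum>i<Suc j. if i = r then e i k else 0)"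
        by (intro sum.cong) auto
      with True show ?thesis by (auto simp del: sum.lessThan_Suc)
    next
      case False
      then show ?thesis by (simp add: lessThan_Suc_atMost)
    qed
    also have "\<dots> = M $$ (r, k)" using rk by (simp add: M_def)
    finally show "(B * A) $$ (r, k) = M $$ (r, k)" .
  qed (use A B M in auto)
  then have "Determinant.det M = Determinant.det B * Determinant.det A"
    using det_mult[OF B A] by simp
  moreover have "Determinant.det B = a j"
  proof -
    have "Determinant.det B = prod_list (diag_mat B)"
      by (rule det_lower_triangular[OF _ B]) (auto simp: B_def)
    also have "\<dots> = (\<Prod>i=0..<Suc j. B $$ (i, i))"
      using B by (simp add: prod_list_diag_prod)
    also have "\<dots> = a j" by (simp add: B_def)
    finally show ?thesis .
  qed
  moreover have "Determinant.det M
      = (\<Sum>i\<le>j. a i * e i j) * Determinant.det (Matrix.mat j j (\<lambda>(i, k). e i k))"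
  proof -
    have "Determinant.det M = (\<Sum>k<Suc j. M $$ (j, k) * cofactor M j k)"
      by (rule laplace_expansion_row[OF M]) simp
    also have "\<dots> = M $$ (j, j) * cofactor M j j"
      using assms by (simp add: M_def)
    also have "mat_delete M j j = Matrix.mat j j (\<lambda>(i, k). e i k)"
      by (rule eq_matI) (auto simp: mat_delete_def M_def)
    then have "cofactor M j j = Determinant.det (Matrix.mat j j (\<lambda>(i, k). e i k))"
      by (simp add: cofactor_def)
    finally show ?thesis by (simp add: M_def)
  qed
  ultimately show ?thesis by (simp add: A_def)
qed

section \<open>Factorization of the Wronskians and the kernel of the chain operators\<close>

lemma dvd_wronskian_poly_prod:
  assumes "k \<le> m" shows "wronskian_poly p q k dvd wronskian_poly_prod p q m"
proof (cases k)
  case (Suc i)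
  then show ?thesis unfolding wronskian_poly_prod_def
    using assms by (intro dvd_prodI) auto
qed simp

text \<open>The last row of the Wronskian matrix is replaced by its image under the chain operator,
  whose leading coefficient is \<open>Q^j\<close>. This is \<open>W_(j+1) = W_j L_j h_(j+1)\<close>
  with denominators cleared.\<close>

lemma wronskian_poly_Suc_of_kernel:
  assumes "\<And>k. k \<in> {1..j} \<Longrightarrow> chain_poly p q m j (q k) (p k) = 0"
  shows "wronskian_poly_prod p q m ^ j * wronskian_poly p q (Suc j)
    = wronskian_poly p q j * chain_poly p q m j (q (Suc j)) (p (Suc j))"
proof -
  obtain a where a: "a j = wronskian_poly_prod p q m ^ j"
    "\<And>r u. chain_poly p q m j r u = (\<Sum>i\<le>j. a i * (twisted_pderiv r ^^ i) u)"
    using chain_poly_expand by metis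
  have "(\<Sum>i\<le>j. a i * (twisted_pderiv (q (Suc k)) ^^ i) (p (Suc k))) = 0" if "k < j" for k
    using assms[of "Suc k"] that a by simp
  from det_replace_last_row[of j a "\<lambda>i k. (twisted_pderiv (q (Suc k)) ^^ i) (p (Suc k))", OF this]
  show ?thesis by (simp add: a wronskian_poly_def mult.commute)
qed

text \<open>For \<open>k <= j\<close> the next step is applied to 0. For \<open>k = j + 1\<close>
  the factorization makes \<open>t\<close> equal to \<open>Q^j W_(j+1) / W_j\<close>, and
  \<open>chain_coeff\<close> is \<open>Q\<close> times the logarithmic derivative of
  \<open>t e^(q_(j+1))\<close>, so the next step kills it.\<close>

lemma chain_poly_kernel:
  assumes nz: "\<And>k. k \<in> {1..m} \<Longrightarrow> wronskian_poly p q k \<noteq> 0"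
    and "j \<le> m" "k \<in> {1..j}"
  shows "chain_poly p q m j (q k) (p k) = 0"
  using assms(2,3)
proof (induction j arbitrary: k)
  case (Suc j)
  show ?case
  proof (cases "k = Suc j")
    case False
    with Suc show ?thesis by (simp add: twisted_pderiv_def)
  next
    case True
    define Q t where "Q = wronskian_poly_prod p q m" and "t = chain_poly p q m j (q k) (p k)"
    define V W where "V = wronskian_poly p q j" and "W = wronskian_poly p q (Suc j)"
    define R S where "R = Q div V" and "S = Q div W"
    have V: "V \<noteq> 0" using nz[of j] Suc.prems by (cases j) (auto simp: V_def)
    have W: "W \<noteq> 0" using nz[of "Suc j"] Suc.prems by (auto simp: W_def)
    have QV: "R * V = Q" and QW: "S * W = Q"
      using Suc.prems by (simp_all add: R_def S_def Q_def V_def W_def dvd_wronskian_poly_prod)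
    have t: "Q ^ j * W = V * t"
      unfolding Q_def V_def W_def t_def True
      by (rule wronskian_poly_Suc_of_kernel) (use Suc in auto)
    \<comment> \<open>Multiplied by \<open>Q\<close>, the power rule needs no exponent
      \<open>j - 1\<close> and covers \<open>j = 0\<close>.\<close>
    have dQ: "Q * pderiv (Q ^ j) = of_nat j * pderiv Q * Q ^ j"
    proof (induction j)
      case (Suc j)
      have "Q * pderiv (Q ^ Suc j) = Q * (Q * pderiv (Q ^ j)) + Q * (pderiv Q * Q ^ j)"
        by (simp add: pderiv_mult algebra_simps)
      then show ?case unfolding Suc by (simp add: algebra_simps)
    qed simp
    \<comment> \<open>Logarithmic differentiation without division: \<open>Q^j W = V t\<close> is
      differentiated and multiplied by \<open>Q\<close>, after which \<open>V\<close> can be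
      cancelled.\<close>
    have "pderiv (Q ^ j) * W + Q ^ j * pderiv W = pderiv V * t + V * pderiv t"
      using arg_cong[OF t, of pderiv] by (simp add: pderiv_mult algebra_simps)
    then have "Q * pderiv (Q ^ j) * W + Q * Q ^ j * pderiv W = Q * pderiv V * t + Q * V * pderiv t"
      by (metis (no_types, lifting) distrib_left mult.assoc)
    then have "of_nat j * pderiv Q * (V * t) + S * pderiv W * (V * t) = R * V * pderiv V * t + Q * V * pderiv t"
      unfolding dQ t[symmetric] QV by (simp add: QW[symmetric] algebra_simps)
    then have "V * (Q * pderiv t - (of_nat j * pderiv Q + S * pderiv W - R * pderiv V) * t) = 0"
      by (simp add: algebra_simps)
    with V have "Q * pderiv t = (of_nat j * pderiv Q + S * pderiv W - R * pderiv V) * t"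
      by simp
    moreover have "chain_poly p q m (Suc j) (q k) (p k)
        = Q * (pderiv t + pderiv (q k) * t)
          - (of_nat j * pderiv Q + S * pderiv W - R * pderiv V + pderiv (q k) * Q) * t"
      by (simp add: twisted_pderiv_def chain_coeff_def Let_def Q_def t_def V_def W_def R_def S_def True)
    ultimately show ?thesis by (simp add: algebra_simps)
  qed
qed simp

section \<open>Sums of polynomials times exponentials\<close>

definition exp_poly_sum ::
  "(nat \<Rightarrow> real poly) \<Rightarrow> nat \<Rightarrow> (nat \<Rightarrow> real poly) \<Rightarrow> real \<Rightarrow> real" where
  "exp_poly_sum q n u x = (\<Sum>k=1..n. poly (u k) x * exp (poly (q k) x))"

lemma has_real_derivative_poly_exp:
  "((\<lambda>x. poly u x * exp (poly r x)) has_real_derivative poly (twisted_pderiv r u) x * exp (poly r x)) (at x)"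
  by (auto intro!: derivative_eq_intros simp: twisted_pderiv_def algebra_simps)

lemma has_real_derivative_exp_poly_sum:
  "(exp_poly_sum q n u has_real_derivative exp_poly_sum q n (\<lambda>k. twisted_pderiv (q k) (u k)) x) (at x)"
  unfolding exp_poly_sum_def by (intro DERIV_sum has_real_derivative_poly_exp)

lemma higher_deriv_poly_exp:
  "(deriv ^^ i) (\<lambda>x. poly u x * exp (poly r x)) = (\<lambda>x. poly ((twisted_pderiv r ^^ i) u) x * exp (poly r x))"
  by (induction i) (auto intro!: DERIV_imp_deriv has_real_derivative_poly_exp)

lemma exp_poly_sum_diff:
  "exp_poly_sum q n (\<lambda>k. u k - v k) x = exp_poly_sum q n u x - exp_poly_sum q n v x"
  by (simp add: exp_poly_sum_def sum_subtractf algebra_simps)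

lemma exp_poly_sum_mult_left:
  "exp_poly_sum q n (\<lambda>k. a * u k) x = poly a x * exp_poly_sum q n u x"
  by (simp add: exp_poly_sum_def sum_distrib_left algebra_simps)

text \<open>Reading the polynomials over the complex numbers gives an entire function, which
  supplies both the power series and the identity theorem on the real line.\<close>

lemma exp_poly_sum_complex_extension:
  obtains F :: "complex \<Rightarrow> complex" where "F holomorphic_on UNIV"
    "\<And>x. F (of_real x) = of_real (exp_poly_sum q n u x)"
proof
  define E :: "real poly \<Rightarrow> complex \<Rightarrow> complex" where "E r = poly (map_poly of_real r)" for r
  have E: "E r (of_real x) = of_real (poly r x)" for r x
    by (induction r) (auto simp: E_def map_poly_pCons)
  show "(\<lambda>z. \<Sum>k=1..n. E (u k) z * exp (E (q k) z)) holomorphic_on UNIV"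
    unfolding E_def by (intro holomorphic_intros)
  show "(\<Sum>k=1..n. E (u k) (of_real x) * exp (E (q k) (of_real x))) = of_real (exp_poly_sum q n u x)" for x
    by (simp add: exp_poly_sum_def E exp_of_real)
qed

lemma real_analytic_on_exp_poly_sum: "real_analytic_on (exp_poly_sum q n u) S"
  unfolding real_analytic_on_def
proof
  fix x
  obtain F :: "complex \<Rightarrow> complex" where F: "F holomorphic_on UNIV"
    "\<And>x. F (of_real x) = of_real (exp_poly_sum q n u x)"
    using exp_poly_sum_complex_extension by metis
  define c where "c k = (deriv ^^ k) F (of_real x) / fact k" for k
  have "(\<lambda>k. Re (c k) * t ^ k) sums exp_poly_sum q n u (x + t)" for t
  proof -
    have "(\<lambda>k. c k * (of_real (x + t) - of_real x) ^ k) sums F (of_real (x + t))"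
      unfolding c_def
      by (rule holomorphic_power_series[where r = "\<bar>t\<bar> + 1"])
        (auto intro: holomorphic_on_subset[OF F(1)] simp: dist_real_def simp del: of_real_add)
    \<comment> \<open>Real parts suffice: the centre, \<open>t\<close> and the values of
      \<open>F\<close> at real points are real.\<close>
    from sums_Re[OF this] show ?thesis
      unfolding F(2) by (simp flip: of_real_power)
  qed
  then show "\<exists>G. (\<lambda>t. exp_poly_sum q n u (x + t)) has_fps_expansion G"
    by (intro exI[of _ "Abs_fps (\<lambda>k. Re (c k))"] has_fps_expansionI) simp
qed

lemma exp_poly_sum_eq_0_if_zero_on_ball:
  assumes "e > 0" "\<And>x. x \<in> ball x0 e \<Longrightarrow> exp_poly_sum q n u x = 0"
  shows "exp_poly_sum q n u x = 0"
proof -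
  obtain F :: "complex \<Rightarrow> complex" where F: "F holomorphic_on UNIV"
    "\<And>x. F (of_real x) = of_real (exp_poly_sum q n u x)"
    using exp_poly_sum_complex_extension by metis
  \<comment> \<open>A real interval is not open in the complex plane, but accumulation at its centre
    is enough for analytic continuation.\<close>
  have "x0 islimpt ball x0 e"
    using assms(1) by (simp add: islimpt_ball)
  then have "of_real x0 islimpt (of_real ` ball x0 e :: complex set)"
    by (rule islimpt_isCont_image) (auto simp: eventually_at intro!: exI[of _ 1])
  then have "F (of_real x) = 0"
    by (rule analytic_continuation[OF F(1), rotated 4]) (auto simp: F(2) assms(2))
  then show ?thesis by (simp add: F(2))
qed

section \<open>Wronskians\<close>

text \<open>Evaluation at \<open>x\<close> is a ring homomorphism and so commutes with the
  determinant.\<close>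

lemma wronskian_poly_eval:
  "Determinant.det (Matrix.mat m m (\<lambda>(i, j). poly ((twisted_pderiv (q (Suc j)) ^^ i) (p (Suc j))) x))
    = poly (wronskian_poly p q m) x"
proof -
  interpret comm_ring_hom "\<lambda>u :: real poly. poly u x"
    by unfold_locales auto
  have "Matrix.mat m m (\<lambda>(i, j). poly ((twisted_pderiv (q (Suc j)) ^^ i) (p (Suc j))) x)
    = map_mat (\<lambda>u. poly u x) (Matrix.mat m m (\<lambda>(i, j). (twisted_pderiv (q (Suc j)) ^^ i) (p (Suc j))))"
    by (rule eq_matI) auto
  then show ?thesis by (simp add: wronskian_poly_def hom_det)
qed

text \<open>Column \<open>j\<close> has the common factor \<open>e^(q_j)\<close>; extracting it is
  right multiplication by the diagonal matrix \<open>D\<close>.\<close>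

lemma wronskian_eq_poly_exp:
  assumes "\<And>j x. j \<in> {1..m} \<Longrightarrow> h j x = poly (p j) x * exp (poly (q j) x)"
  shows "wronskian h m x = poly (wronskian_poly p q m) x * exp (\<Sum>j=1..m. poly (q j) x)"
proof -
  define A where "A = Matrix.mat m m (\<lambda>(i, j). poly ((twisted_pderiv (q (Suc j)) ^^ i) (p (Suc j))) x)"
  define D where "D = Matrix.mat m m (\<lambda>(i, j). if i = j then exp (poly (q (Suc j)) x) else 0)"
  have A: "A \<in> carrier_mat m m" and D: "D \<in> carrier_mat m m"
    by (simp_all add: A_def D_def)
  have "h (Suc j) = (\<lambda>x. poly (p (Suc j)) x * exp (poly (q (Suc j)) x))" if "j < m" for j
    using assms[of "Suc j"] that by auto
  then have "Matrix.mat m m (\<lambda>(i, j). (deriv ^^ i) (h (Suc j)) x)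
      = Matrix.mat m m (\<lambda>(i, j). poly ((twisted_pderiv (q (Suc j)) ^^ i) (p (Suc j))) x * exp (poly (q (Suc j)) x))"
    by (intro eq_matI) (auto simp: higher_deriv_poly_exp)
  also have "\<dots> = A * D"
  proof (rule eq_matI)
    fix i j assume ij: "i < dim_row (A * D)" "j < dim_col (A * D)"
    then have "(A * D) $$ (i, j) = (\<Sum>k<m. A $$ (i, k) * D $$ (k, j))"
      using A D by (simp add: times_mat_def scalar_prod_def atLeast0LessThan)
    also have "\<dots> = (\<Sum>k<m. if k = j then A $$ (i, j) * exp (poly (q (Suc j)) x) else 0)"
      using ij by (intro sum.cong) (auto simp: D_def)
    also have "\<dots> = A $$ (i, j) * exp (poly (q (Suc j)) x)"
      using ij D by simp
    finally show "Matrix.mat m m (\<lambda>(i, j). poly ((twisted_pderiv (q (Suc j)) ^^ i) (p (Suc j))) x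
        * exp (poly (q (Suc j)) x)) $$ (i, j) = (A * D) $$ (i, j)"
      using ij by (simp add: A_def D_def)
  qed (simp_all add: A_def D_def)
  finally have "wronskian h m x = Determinant.det A * Determinant.det D"
    using det_mult[OF A D] by (simp add: wronskian_def)
  moreover have "Determinant.det D = exp (\<Sum>j=1..m. poly (q j) x)"
  proof -
    have "Determinant.det D = prod_list (diag_mat D)"
      by (rule det_lower_triangular[OF _ D]) (auto simp: D_def)
    also have "\<dots> = (\<Prod>i=0..<m. exp (poly (q (Suc i)) x))"
      using D by (simp add: prod_list_diag_prod D_def)
    also have "\<dots> = exp (\<Sum>i=0..<m. poly (q (Suc i)) x)"
      by (simp add: exp_sum)
    also have "(\<Sum>i=0..<m. poly (q (Suc i)) x) = (\<Sum>j=1..m. poly (q j) x)"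
      by (rule sum.reindex_bij_witness[of _ "\<lambda>j. j - 1" Suc]) auto
    finally show ?thesis .
  qed
  ultimately show ?thesis by (simp add: A_def wronskian_poly_eval)
qed

section \<open>Linear independence and nonvanishing of the Wronskians\<close>

lemma poly_wronskian_poly_prod_nonzero:
  assumes "poly (wronskian_poly_prod p q m) x \<noteq> 0" "k \<le> m"
  shows "poly (wronskian_poly p q k) x \<noteq> 0"
  using dvd_wronskian_poly_prod[OF assms(2), of p q] assms(1) by (auto elim!: dvdE)

lemma exp_poly_sum_single:
  assumes "j \<in> {1..n}"
  shows "exp_poly_sum q n (\<lambda>k. if k = j then u else 0) x = poly u x * exp (poly (q j) x)"
proof -
  have "exp_poly_sum q n (\<lambda>k. if k = j then u else 0) x
      = (\<Sum>k=1..n. if k = j then poly u x * exp (poly (q j) x) else 0)"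
    unfolding exp_poly_sum_def by (intro sum.cong) auto
  with assms show ?thesis by simp
qed

text \<open>
  Induction from the outside in: two solutions of the first order equation \<open>Q y' = s y\<close> are
  proportional, so one step of the chain can be peeled off after subtracting a multiple of \<open>h\<^sub>j\<close>.
\<close>
lemma chain_poly_kernel_on_ball:
  assumes nz: "\<And>k. k \<in> {1..m} \<Longrightarrow> wronskian_poly p q k \<noteq> 0"
    and ball: "\<And>x. x \<in> ball x0 e \<Longrightarrow> poly (wronskian_poly_prod p q m) x \<noteq> 0"
    and "j \<le> m" "m \<le> n"
    and "\<And>x. x \<in> ball x0 e \<Longrightarrow> exp_poly_sum q n (\<lambda>k. chain_poly p q m j (q k) (u k)) x = 0"
  shows "\<exists>c. \<forall>x \<in> ball x0 e. exp_poly_sum q n u x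
    = (\<Sum>k=1..j. c k * (poly (p k) x * exp (poly (q k) x)))"
  using assms(3,5)
proof (induction j arbitrary: u)
  case (Suc j)
  define Q s where "Q = wronskian_poly_prod p q m" and "s = chain_coeff p q m j"
  define t where "t = chain_poly p q m j (q (Suc j)) (p (Suc j))"
  define g where "g = exp_poly_sum q n (\<lambda>k. chain_poly p q m j (q k) (u k))"
  define v where "v x = poly t x * exp (poly (q (Suc j)) x)" for x
  define g' where "g' = exp_poly_sum q n (\<lambda>k. twisted_pderiv (q k) (chain_poly p q m j (q k) (u k)))"
  define v' where "v' x = poly (twisted_pderiv (q (Suc j)) t) x * exp (poly (q (Suc j)) x)" for x
  have g: "(g has_real_derivative g' x) (at x)" for x
    unfolding g_def g'_def by (rule has_real_derivative_exp_poly_sum)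
  have v: "(v has_real_derivative v' x) (at x)" for x
    unfolding v_def v'_def by (rule has_real_derivative_poly_exp)
  have g_eq: "poly Q x * g' x = poly s x * g x" if "x \<in> ball x0 e" for x
    using Suc.prems(2)[OF that]
    by (simp add: exp_poly_sum_diff exp_poly_sum_mult_left Q_def s_def g_def g'_def)
  have "chain_poly p q m (Suc j) (q (Suc j)) (p (Suc j)) = 0"
    by (rule chain_poly_kernel[OF nz]) (use Suc.prems in auto)
  then have "Q * twisted_pderiv (q (Suc j)) t = s * t"
    by (simp add: Q_def s_def t_def)
  from arg_cong[OF this, of poly] have v_eq: "poly Q x * v' x = poly s x * v x" for x
    by (simp add: v_def v'_def fun_eq_iff mult.assoc[symmetric] flip: poly_mult)
  \<comment> \<open>The factorization of \<open>W_(j+1)\<close> rules out zeros of \<open>v\<close>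
    on the ball, so \<open>g / v\<close> may be formed there.\<close>
  have "Q ^ j * wronskian_poly p q (Suc j) = wronskian_poly p q j * t"
    unfolding Q_def t_def
    by (rule wronskian_poly_Suc_of_kernel, rule chain_poly_kernel[OF nz]) (use Suc.prems in auto)
  then have "poly (Q ^ j * wronskian_poly p q (Suc j)) x = poly (wronskian_poly p q j * t) x" for x
    by simp
  moreover have "poly Q x \<noteq> 0" "poly (wronskian_poly p q (Suc j)) x \<noteq> 0" if "x \<in> ball x0 e" for x
    using ball[OF that] Suc.prems(1) by (auto simp: Q_def dest: poly_wronskian_poly_prod_nonzero)
  ultimately have v_nz: "v x \<noteq> 0" if "x \<in> ball x0 e" for x
    using that unfolding v_def by (metis exp_not_eq_zero mult_eq_0_iff poly_mult poly_power power_eq_0_iff)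
  have "((\<lambda>x. g x / v x) has_field_derivative 0) (at x within ball x0 e)" if x: "x \<in> ball x0 e" for x
  proof -
    have "poly Q x * (g' x * v x - g x * v' x) = 0"
      using g_eq[OF x] v_eq[of x] by (simp add: algebra_simps)
    then have "g' x * v x - g x * v' x = 0"
      using ball[OF x] by (simp add: Q_def)
    with DERIV_divide[OF g[of x] v[of x] v_nz[OF x]] show ?thesis
      by (simp add: has_field_derivative_at_within)
  qed
  then have "\<exists>c. \<forall>x \<in> ball x0 e. g x / v x = c"
    by (rule has_field_derivative_zero_constant[OF convex_ball])
  then obtain c where c: "\<And>x. x \<in> ball x0 e \<Longrightarrow> g x / v x = c" by auto
  have c: "g x = c * v x" if "x \<in> ball x0 e" for x
    using c[OF that] v_nz[OF that] by (simp add: nonzero_divide_eq_eq)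
  \<comment> \<open>\<open>w\<close> represents \<open>c h_(j+1)\<close>, which the operator of
    order \<open>j\<close> sends to \<open>c v\<close>. Subtracting it cancels
    \<open>g = c v\<close>, and the induction hypothesis applies.\<close>
  define w where "w k = (if k = Suc j then [:c:] * p (Suc j) else 0)" for k
  have single: "exp_poly_sum q n w x = c * (poly (p (Suc j)) x * exp (poly (q (Suc j)) x))" for x
    using exp_poly_sum_single[of "Suc j" n q "[:c:] * p (Suc j)" x] Suc.prems(1) \<open>m \<le> n\<close>
    by (simp add: w_def[abs_def])
  have "exp_poly_sum q n (\<lambda>k. chain_poly p q m j (q k) (u k - w k)) x = 0" if "x \<in> ball x0 e" for x
  proof -
    have "chain_poly p q m j (q k) (w k) = (if k = Suc j then [:c:] * t else 0)" for k
      by (simp add: w_def t_def chain_poly_const_mult chain_poly_0_right del: mult_pCons_left)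
    then have "exp_poly_sum q n (\<lambda>k. chain_poly p q m j (q k) (u k - w k)) x
        = g x - c * v x"
      using exp_poly_sum_single[of "Suc j" n q "[:c:] * t" x] Suc.prems(1) \<open>m \<le> n\<close>
      by (simp add: chain_poly_diff exp_poly_sum_diff g_def v_def)
    with c[OF that] show ?thesis by simp
  qed
  with Suc.IH[of "\<lambda>k. u k - w k"] Suc.prems(1) obtain d where
    d: "\<And>x. x \<in> ball x0 e \<Longrightarrow> exp_poly_sum q n (\<lambda>k. u k - w k) x
      = (\<Sum>k=1..j. d k * (poly (p k) x * exp (poly (q k) x)))"
    by auto
  have "exp_poly_sum q n u x = (\<Sum>k=1..Suc j. (d(Suc j := c)) k * (poly (p k) x * exp (poly (q k) x)))"
    if "x \<in> ball x0 e" for x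
    using d[OF that] by (simp add: exp_poly_sum_diff single)
  then show ?case by blast
qed simp

text \<open>The induction is strong because the kernel of the operator of order \<open>m - 1\<close>
  is known only once all earlier Wronskians are nonzero.\<close>

lemma wronskian_poly_nonzero:
  assumes h: "\<And>j x. j \<in> {1..n} \<Longrightarrow> h j x = poly (p j) x * exp (poly (q j) x)"
    and indep: "lin_indep_functions h n" and "m \<le> n"
  shows "wronskian_poly p q m \<noteq> 0"
  using \<open>m \<le> n\<close>
proof (induction m rule: less_induct)
  case (less m)
  show ?case
  proof (cases m)
    case (Suc l)
    have nz: "wronskian_poly p q k \<noteq> 0" if "k \<in> {1..l}" for k
      using less Suc that by auto
    \<comment> \<open>The product stops at \<open>l = m - 1\<close>, so that \<open>Q\<close> does
      not contain the factor assumed to vanish.\<close>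
    define Q t where "Q = wronskian_poly_prod p q l" and "t = chain_poly p q l l (q m) (p m)"
    have "Q \<noteq> 0" using nz by (simp add: Q_def wronskian_poly_prod_def)
    show ?thesis
    proof
      assume "wronskian_poly p q m = 0"
      moreover have "Q ^ l * wronskian_poly p q (Suc l) = wronskian_poly p q l * t"
        unfolding Q_def t_def Suc
        by (rule wronskian_poly_Suc_of_kernel, rule chain_poly_kernel[OF nz]) auto
      moreover have "wronskian_poly p q l \<noteq> 0"
        using nz[of l] by (cases l) auto
      ultimately have t: "t = 0" by (simp add: Suc)
      define u where "u k = (if k = m then p m else 0)" for k
      have m: "m \<in> {1..n}" using less.prems Suc by simp
      obtain x0 where "poly Q x0 \<noteq> 0"
        using \<open>Q \<noteq> 0\<close> poly_all_0_iff_0 by blast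
      moreover have "open {x. poly Q x \<noteq> 0}"
        by (intro open_Collect_neq continuous_intros)
      ultimately obtain e where e: "e > 0" "ball x0 e \<subseteq> {x. poly Q x \<noteq> 0}"
        unfolding open_contains_ball by blast
      have "chain_poly p q l l (q k) (u k) = 0" for k
        using t by (simp add: u_def t_def chain_poly_0_right)
      then have "\<exists>c. \<forall>x \<in> ball x0 e. exp_poly_sum q n u x
          = (\<Sum>k=1..l. c k * (poly (p k) x * exp (poly (q k) x)))"
        using e m Suc
        by (intro chain_poly_kernel_on_ball[where m = l] nz) (auto simp: Q_def exp_poly_sum_def)
      then obtain c where c: "\<And>x. x \<in> ball x0 e \<Longrightarrow> exp_poly_sum q n u x
          = (\<Sum>k=1..l. c k * (poly (p k) x * exp (poly (q k) x)))" by blast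
      \<comment> \<open>The local combination of \<open>h_1, ..., h_l\<close> is moved to the side
        of \<open>h_m\<close>; the entry 1 at \<open>m\<close> is what contradicts
        independence.\<close>
      define d where "d k = (if k = m then 1 else if k \<le> l then - c k else 0)" for k
      have d: "(\<Sum>k=1..n. d k * h k x) = exp_poly_sum q n (\<lambda>k. [:d k:] * p k) x" for x
        by (simp add: exp_poly_sum_def h mult.assoc)
      have "exp_poly_sum q n (\<lambda>k. [:d k:] * p k) x = 0" if "x \<in> ball x0 e" for x
      proof -
        have "exp_poly_sum q n (\<lambda>k. [:d k:] * p k) x
            = (\<Sum>k=1..m. d k * (poly (p k) x * exp (poly (q k) x)))"
          unfolding exp_poly_sum_def
          by (rule sum.mono_neutral_cong_right) (use m Suc in \<open>auto simp: d_def\<close>)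
        also have "\<dots> = (\<Sum>k=1..l. - (c k * (poly (p k) x * exp (poly (q k) x))))
            + poly (p m) x * exp (poly (q m) x)"
          unfolding Suc by (simp add: d_def Suc)
        also have "\<dots> = 0"
          using c[OF that] exp_poly_sum_single[OF m, of q "p m" x]
          by (simp add: sum_negf u_def[abs_def])
        finally show ?thesis .
      qed
      \<comment> \<open>The identity theorem carries the relation from the ball to the whole line,
        where independence is assumed.\<close>
      then have "(\<Sum>k=1..n. d k * h k x) = 0" for x
        unfolding d using exp_poly_sum_eq_0_if_zero_on_ball[OF e(1)] by blast
      then have "\<forall>k\<in>{1..n}. d k = 0"
        using indep unfolding lin_indep_functions_def by blast
      then have "d m = 0" using m by blast
      then show False by (simp add: d_def)
    qed
  qed simp
qed

section \<open>The Wronskian chain\<close>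

lemma mero_val_cong:
  assumes "\<forall>\<^sub>F t in at x. f t = g t"
  shows "mero_val f x = mero_val g x"
  using tendsto_cong[OF assms] Lim_cong[OF assms refl]
  by (simp add: mero_val_def mero_defined_at_def)

lemma mero_val_isCont:
  assumes "isCont f x"
  shows "mero_val f x = f x"
  using assms tendsto_Lim[of "at x" f "f x"]
  by (auto simp: mero_val_def mero_defined_at_def isCont_def)

lemma eventually_at_poly_nonzero:
  fixes Q :: "real poly"
  assumes "Q \<noteq> 0"
  shows "\<forall>\<^sub>F t in at x. poly Q t \<noteq> 0"
proof -
  have "\<not> x islimpt {t. poly Q t = 0}"
    using poly_roots_finite[OF assms] islimpt_finite by blast
  then show ?thesis by (simp add: islimpt_iff_eventually)
qed

lemma eventually_nhds_poly_nonzero: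
  fixes Q :: "real poly"
  assumes "poly Q x \<noteq> 0"
  shows "\<forall>\<^sub>F t in nhds x. poly Q t \<noteq> 0"
proof -
  have "open {t. poly Q t \<noteq> 0}"
    by (intro open_Collect_neq continuous_intros)
  with assms show ?thesis unfolding eventually_nhds by blast
qed

lemma poly_nonzero_in_interval:
  fixes Q :: "real poly"
  assumes "Q \<noteq> 0" "a < b"
  obtains x where "x \<in> {a..b}" "poly Q x \<noteq> 0"
proof -
  have "infinite ({a..b} - {t. poly Q t = 0})"
    using poly_roots_finite[OF assms(1)] assms(2) by (simp add: infinite_Icc)
  then obtain x where "x \<in> {a..b} - {t. poly Q t = 0}"
    by (metis finite.emptyI ex_in_conv)
  with that show thesis by auto
qed

text \<open>\<open>L_j f\<close> in closed form, the factor \<open>Q^j\<close> of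
  \<open>chain_poly\<close> being divided out. For \<open>j > 0\<close> it has the default value 0
  at the roots of \<open>Q\<close>, so it is compared with the chain only away from them.\<close>

definition chain_val ::
  "(nat \<Rightarrow> real poly) \<Rightarrow> (nat \<Rightarrow> real poly) \<Rightarrow> nat \<Rightarrow> nat \<Rightarrow> real \<Rightarrow> real" where
  "chain_val p q n j x = exp_poly_sum q n (\<lambda>k. chain_poly p q n j (q k) (p k)) x
     / poly (wronskian_poly_prod p q n) x ^ j"

lemma isCont_chain_val:
  assumes "poly (wronskian_poly_prod p q n) x \<noteq> 0"
  shows "isCont (chain_val p q n j) x"
  unfolding chain_val_def
  using assms DERIV_isCont[OF has_real_derivative_exp_poly_sum] by (intro continuous_intros) auto

section \<open>The closed form under one step of the chain\<close>

lemma wronskian_quotient: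
  assumes h: "\<And>j x. j \<in> {1..n} \<Longrightarrow> h j x = poly (p j) x * exp (poly (q j) x)"
    and "Suc j \<le> n"
  shows "wronskian h j x / wronskian h (Suc j) x
      = poly (wronskian_poly p q j) x / poly (wronskian_poly p q (Suc j)) x * exp (- poly (q (Suc j)) x)"
    and "wronskian h (Suc j) x / wronskian h j x
      = poly (wronskian_poly p q (Suc j)) x / poly (wronskian_poly p q j) x * exp (poly (q (Suc j)) x)"
proof -
  have *: "wronskian h i x = poly (wronskian_poly p q i) x * exp (\<Sum>k=1..i. poly (q k) x)" if "i \<le> n" for i
    by (rule wronskian_eq_poly_exp) (use that in \<open>auto intro: h\<close>)
  show "wronskian h j x / wronskian h (Suc j) x
      = poly (wronskian_poly p q j) x / poly (wronskian_poly p q (Suc j)) x * exp (- poly (q (Suc j)) x)"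
    "wronskian h (Suc j) x / wronskian h j x
      = poly (wronskian_poly p q (Suc j)) x / poly (wronskian_poly p q j) x * exp (poly (q (Suc j)) x)"
    using assms(2) by (simp_all add: * exp_add exp_minus field_simps)
qed

text \<open>The field arithmetic of one step, kept apart from the calculus. \<open>V\<close> and
  \<open>W\<close> stand for values of consecutive Wronskian polynomials, \<open>E\<close> for
  \<open>e^(q_(j+1))\<close>, \<open>P\<close> for \<open>Q^j\<close>, \<open>J\<close> for
  \<open>j\<close> and \<open>r\<close> for the derivative of \<open>q_(j+1)\<close>.\<close>

lemma log_derivative_identity:
  fixes V V' W W' E g g' P Q Q' r J :: real
  assumes "V \<noteq> 0" "W \<noteq> 0" "E \<noteq> 0" "P \<noteq> 0" "Q \<noteq> 0"
  shows "W / V * E * ((V' * W - V * W') / W\<^sup>2 / E * (g / P) - V / W * r / E * (g / P)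
     + V / W / E * (g' / P - J * Q' * g / (Q * P)))
   = (Q * g' - (J * Q' + Q / W * W' - Q / V * V' + r * Q) * g) / (Q * P)"
  using assms by (simp add: divide_simps power2_eq_square) (simp add: algebra_simps)

text \<open>With \<open>rho = W_(j+1) / W_j\<close> the left side is
  \<open>phi' - (rho' / rho) phi\<close> for \<open>phi = g / Q^j\<close>; multiplied by
  \<open>Q^(j+1)\<close> it becomes the recursion of \<open>chain_poly\<close>.\<close>

lemma deriv_chain_val:
  assumes h: "\<And>j x. j \<in> {1..n} \<Longrightarrow> h j x = poly (p j) x * exp (poly (q j) x)"
    and "Suc j \<le> n" and nz: "poly (wronskian_poly_prod p q n) x \<noteq> 0"
  shows "wronskian h (Suc j) x / wronskian h j x *
    deriv (\<lambda>t. wronskian h j t / wronskian h (Suc j) t * chain_val p q n j t) x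
    = chain_val p q n (Suc j) x"
proof -
  define Q where "Q = wronskian_poly_prod p q n"
  define V W where "V = wronskian_poly p q j" and "W = wronskian_poly p q (Suc j)"
  define R S where "R = Q div V" and "S = Q div W"
  define g where "g = exp_poly_sum q n (\<lambda>k. chain_poly p q n j (q k) (p k))"
  define g' where "g' = exp_poly_sum q n (\<lambda>k. twisted_pderiv (q k) (chain_poly p q n j (q k) (p k)))"
  define E where "E = exp (poly (q (Suc j)) x)"
  have E: "E \<noteq> 0" "exp (- poly (q (Suc j)) x) = 1 / E"
    by (simp_all add: E_def exp_minus field_simps)
  have g: "(g has_real_derivative g' x) (at x)"
    unfolding g_def g'_def by (rule has_real_derivative_exp_poly_sum)
  have nz': "poly Q x \<noteq> 0" "poly V x \<noteq> 0" "poly W x \<noteq> 0"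
    using nz poly_wronskian_poly_prod_nonzero[OF nz] assms(2) by (auto simp: Q_def V_def W_def)
  have "R * V = Q" "S * W = Q"
    using assms(2) by (simp_all add: R_def S_def Q_def V_def W_def dvd_wronskian_poly_prod)
  then have "poly R x * poly V x = poly Q x" "poly S x * poly W x = poly Q x"
    by (metis poly_mult)+
  then have RS: "poly R x = poly Q x / poly V x" "poly S x = poly Q x / poly W x"
    using nz' by (simp_all add: nonzero_eq_divide_eq)
  have VW: "((\<lambda>t. poly V t / poly W t) has_real_derivative
      (poly (pderiv V) x * poly W x - poly V x * poly (pderiv W) x) / (poly W x)\<^sup>2) (at x)"
    using nz' by (auto intro!: derivative_eq_intros simp: power2_eq_square)
  have r: "((\<lambda>t. exp (- poly (q (Suc j)) t)) has_real_derivative - poly (pderiv (q (Suc j))) x / E) (at x)"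
    by (rule derivative_eq_intros poly_DERIV refl)+ (simp add: E)
  have gQ: "((\<lambda>t. g t / poly Q t ^ j) has_real_derivative
      g' x / poly Q x ^ j - of_nat j * poly (pderiv Q) x * g x / poly Q x ^ Suc j) (at x)"
  proof -
    have "((\<lambda>t. poly Q t ^ j) has_real_derivative of_nat j * (poly (pderiv Q) x * poly Q x ^ (j - 1))) (at x)"
      using DERIV_power[OF poly_DERIV[of Q x], of j] by simp
    \<comment> \<open>The case \<open>j = 0\<close> is separate because \<open>j - 1\<close> is
      truncated there.\<close>
    from DERIV_divide[OF g this] nz' show ?thesis
      by (cases j) (auto elim!: DERIV_cong simp: field_simps)
  qed
  have "((\<lambda>t. poly V t / poly W t * exp (- poly (q (Suc j)) t) * (g t / poly Q t ^ j))
    has_real_derivative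
      ((poly (pderiv V) x * poly W x - poly V x * poly (pderiv W) x) / (poly W x)\<^sup>2 / E * (g x / poly Q x ^ j)
       - poly V x / poly W x * poly (pderiv (q (Suc j))) x / E * (g x / poly Q x ^ j)
       + poly V x / poly W x / E *
         (g' x / poly Q x ^ j - of_nat j * poly (pderiv Q) x * g x / poly Q x ^ Suc j))) (at x)"
    by (rule DERIV_cong[OF DERIV_mult[OF DERIV_mult[OF VW r] gQ]])
      (simp add: E divide_inverse algebra_simps)
  moreover have "(\<lambda>t. wronskian h j t / wronskian h (Suc j) t * chain_val p q n j t)
      = (\<lambda>t. poly V t / poly W t * exp (- poly (q (Suc j)) t) * (g t / poly Q t ^ j))"
    using wronskian_quotient(1)[OF h assms(2)]
    by (intro ext) (simp add: chain_val_def V_def W_def g_def Q_def)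
  ultimately have "deriv (\<lambda>t. wronskian h j t / wronskian h (Suc j) t * chain_val p q n j t) x = 
      ((poly (pderiv V) x * poly W x - poly V x * poly (pderiv W) x) / (poly W x)\<^sup>2 / E * (g x / poly Q x ^ j)
       - poly V x / poly W x * poly (pderiv (q (Suc j))) x / E * (g x / poly Q x ^ j)
       + poly V x / poly W x / E *
         (g' x / poly Q x ^ j - of_nat j * poly (pderiv Q) x * g x / poly Q x ^ Suc j))"
    by (simp only:) (rule DERIV_imp_deriv)
  moreover have "chain_val p q n (Suc j) x = (poly Q x * g' x - 
      (of_nat j * poly (pderiv Q) x + poly S x * poly (pderiv W) x
     - poly R x * poly (pderiv V) x + poly (pderiv (q (Suc j))) x * poly Q x) * g x) / poly Q x ^ Suc j"
    by (simp add: chain_val_def exp_poly_sum_diff exp_poly_sum_mult_left chain_coeff_def Let_def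
       Q_def V_def W_def R_def S_def g_def g'_def)
  moreover have "wronskian h (Suc j) x / wronskian h j x = poly W x / poly V x * E"
    using wronskian_quotient(2)[OF h assms(2)] by (simp add: W_def V_def E_def)
  ultimately show ?thesis
    using log_derivative_identity[of "poly V x" "poly W x" E "poly Q x ^ j" "poly Q x"
        "poly (pderiv V) x" "poly (pderiv W) x" "g x" "poly (pderiv (q (Suc j))) x" "g' x" "of_nat j"
        "poly (pderiv Q) x"] nz' E(1)
    unfolding RS power_Suc by simp
qed

text \<open>\<open>deriv\<close> sees a whole neighbourhood, so the induction carries equality on
  the open set where \<open>Q\<close> is nonzero. There \<open>chain_val\<close> is continuous, and
  \<open>mero_val\<close> returns its ordinary value.\<close>

lemma wronskian_chain_eq_chain_val:
  assumes h: "\<And>j x. j \<in> {1..n} \<Longrightarrow> h j x = poly (p j) x * exp (poly (q j) x)"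
    and f: "\<And>x. f x = (\<Sum>j=1..n. h j x)"
    and "j \<le> n" "poly (wronskian_poly_prod p q n) x \<noteq> 0"
  shows "wronskian_chain h f j x = chain_val p q n j x"
  using assms(3,4)
proof (induction j arbitrary: x)
  case 0
  show ?case by (simp add: chain_val_def exp_poly_sum_def f h)
next
  case (Suc j)
  let ?G = "\<lambda>x. wronskian h (Suc j) x / wronskian h j x *
    deriv (\<lambda>t. wronskian h j t / wronskian h (Suc j) t * wronskian_chain h f j t) x"
  have G: "?G x = chain_val p q n (Suc j) x" if nz: "poly (wronskian_poly_prod p q n) x \<noteq> 0" for x
  proof -
    have "\<forall>\<^sub>F t in nhds x. wronskian h j t / wronskian h (Suc j) t * wronskian_chain h f j t
        = wronskian h j t / wronskian h (Suc j) t * chain_val p q n j t"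
      using eventually_nhds_poly_nonzero[OF nz] by eventually_elim (use Suc in auto)
    from deriv_cong_ev[OF this refl] show ?thesis
      using deriv_chain_val[of n h p q j x, OF h] nz Suc.prems(1) by simp
  qed
  have "\<forall>\<^sub>F t in at x. ?G t = chain_val p q n (Suc j) t"
    using eventually_nhds_poly_nonzero[OF Suc.prems(2)] unfolding eventually_at_filter
    by eventually_elim (use G in auto)
  then have "mero_val ?G x = mero_val (chain_val p q n (Suc j)) x"
    by (rule mero_val_cong)
  then show ?case
    using mero_val_isCont[OF isCont_chain_val[OF Suc.prems(2)]] by simp
qed

theorem mainTheorem2:
  fixes n :: nat
    and p q :: "nat \<Rightarrow> real poly"
    and h :: "nat \<Rightarrow> real \<Rightarrow> real"
    and f :: "real \<Rightarrow> real"
  assumes "n \<ge> 1"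
    and "\<And>j. j \<in> {1..n} \<Longrightarrow> degree (q j) \<le> 2"
    and "\<And>j x. j \<in> {1..n} \<Longrightarrow> h j x = poly (p j) x * exp (poly (q j) x)"
    and "lin_indep_functions h n"
    and "\<And>x. f x = (\<Sum>j=1..n. h j x)"
  shows "(\<forall>m\<in>{1..n}. \<exists>P :: real poly. P \<noteq> 0 \<and>
            (\<forall>x. wronskian h m x = poly P x * exp (\<Sum>j=1..m. poly (q j) x)))
       \<and> (\<forall>x. wronskian_chain h f n x = 0)
       \<and> (\<forall>a b. a < b \<longrightarrow>
            GBF_sequence f a b n (wronskian_chain h f)
              (\<lambda>k x. wronskian h k x / wronskian h (k - 1) x))"
proof -
  note h = assms(3) and f = assms(5)
  define Q where "Q = wronskian_poly_prod p q n"
  have W_nz: "wronskian_poly p q m \<noteq> 0" if "m \<le> n" for m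
    using wronskian_poly_nonzero[OF h assms(4) that] .
  have W: "wronskian h m x = poly (wronskian_poly p q m) x * exp (\<Sum>j=1..m. poly (q j) x)"
    if "m \<le> n" for m x
    by (rule wronskian_eq_poly_exp) (use that in \<open>auto intro: h\<close>)
  have Q: "Q \<noteq> 0" using W_nz by (simp add: Q_def wronskian_poly_prod_def)
  have W_x_nz: "wronskian h m x \<noteq> 0" if "m \<le> n" "poly Q x \<noteq> 0" for m x
    using poly_wronskian_poly_prod_nonzero[of p q n x m] that by (simp add: W Q_def)
  have chain: "wronskian_chain h f j x = chain_val p q n j x" if "j \<le> n" "poly Q x \<noteq> 0" for j x
    using wronskian_chain_eq_chain_val[OF h f] that by (simp add: Q_def)
  have "chain_val p q n n x = 0" for x
    using chain_poly_kernel[of n p q n] W_nz by (simp add: chain_val_def exp_poly_sum_def)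
  with chain have chain_n: "wronskian_chain h f n x = 0" if "poly Q x \<noteq> 0" for x
    using that by simp
  \<comment> \<open>At a root of \<open>Q\<close> the value is a limit, and the function under
    \<open>mero_val\<close> vanishes on a punctured neighbourhood. The last member has this form
    because \<open>n >= 1\<close>.\<close>
  have last_zero: "wronskian_chain h f n x = 0" for x
  proof -
    obtain l where n: "n = Suc l" using assms(1) by (cases n) auto
    let ?G = "\<lambda>x. wronskian h n x / wronskian h l x *
      deriv (\<lambda>t. wronskian h l t / wronskian h n t * wronskian_chain h f l t) x"
    have G: "?G t = 0" if t: "poly Q t \<noteq> 0" for t
    proof -
      have "\<forall>\<^sub>F s in nhds t. wronskian h l s / wronskian h n s * wronskian_chain h f l s
        = wronskian h l s / wronskian h n s * chain_val p q n l s"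
        using eventually_nhds_poly_nonzero[OF t] by eventually_elim (simp add: chain n)
      from deriv_cong_ev[OF this refl] have "?G t = chain_val p q n n t"
        using deriv_chain_val[of n h p q l t, OF h] t n by (simp add: Q_def)
      also have "\<dots> = 0" using chain chain_n t by simp
      finally show ?thesis .
    qed
    have "\<forall>\<^sub>F t in at x. ?G t = 0"
      using eventually_at_poly_nonzero[OF Q] by eventually_elim (rule G)
    from mero_val_cong[OF this] show ?thesis
      by (simp add: n mero_val_isCont)
  qed
  have W_analytic: "real_analytic_on (wronskian h m) S" if "m \<le> n" for m S
  proof -
    have "wronskian h m = exp_poly_sum (\<lambda>_. \<Sum>j=1..m. q j) 1 (\<lambda>_. wronskian_poly p q m)"
      using that by (auto simp: W exp_poly_sum_def poly_sum)
    then show ?thesis using real_analytic_on_exp_poly_sum by simp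
  qed
  have "GBF_sequence f a b n (wronskian_chain h f) (\<lambda>k x. wronskian h k x / wronskian h (k - 1) x)"
    if ab: "a < b" for a b
    unfolding GBF_sequence_def
  proof (intro conjI ballI impI)
    \<comment> \<open>Finitely many roots cannot cover a nondegenerate interval; \<open>x0\<close>
      witnesses every nonvanishing claim below.\<close>
    obtain x0 where x0: "x0 \<in> {a..b}" "poly Q x0 \<noteq> 0"
      using poly_nonzero_in_interval[OF Q ab] .
    have "f = exp_poly_sum q n p" by (auto simp: f h exp_poly_sum_def)
    then show "real_analytic_on f {a..b}" using real_analytic_on_exp_poly_sum by simp
    show "wronskian_chain h f 0 x = f x" for x by simp
    show "wronskian_chain h f n x = 0" for x by (rule last_zero)
    fix i assume i: "i \<in> {1..n}"
    show "analytic_quotient_on (wronskian_chain h f i) a b"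
      unfolding analytic_quotient_on_def
    proof (intro exI conjI)
      let ?g = "exp_poly_sum q n (\<lambda>k. chain_poly p q n i (q k) (p k))"
      \<comment> \<open>The denominator \<open>Q^i\<close> is encoded with exponent 0, so that the
        same analyticity lemma covers it and the numerator.\<close>
      let ?h = "exp_poly_sum (\<lambda>_. 0) 1 (\<lambda>_. Q ^ i)"
      have h_eq: "?h x = poly Q x ^ i" for x by (simp add: exp_poly_sum_def)
      show "real_analytic_on ?g {a..b}" "real_analytic_on ?h {a..b}"
        by (rule real_analytic_on_exp_poly_sum)+
      show "\<exists>x\<in>{a..b}. ?h x \<noteq> 0" unfolding h_eq using x0 by auto
      show "\<forall>c\<in>{a..b}. \<forall>\<^sub>F x in nhds c. ?h x \<noteq> 0 \<longrightarrow> wronskian_chain h f i x = ?g x / ?h x"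
        unfolding h_eq using i by (auto simp: chain chain_val_def Q_def intro!: always_eventually)
    qed
    show "analytic_quotient_on (\<lambda>x. wronskian h i x / wronskian h (i - 1) x) a b"
      unfolding analytic_quotient_on_def
      using i x0 W_x_nz W_analytic
      by (intro exI[of _ "wronskian h i"] exI[of _ "wronskian h (i - 1)"] conjI bexI[of _ x0]) auto
    show "\<exists>x\<in>{a..b}. mero_val (\<lambda>x. wronskian h i x / wronskian h (i - 1) x) x \<noteq> 0"
    proof (intro bexI[OF _ x0(1)])
      have "continuous (at x0) (\<lambda>x. wronskian h m x)" if "m \<le> n" for m
        using that by (simp add: W)
      then have "isCont (\<lambda>x. wronskian h i x / wronskian h (i - 1) x) x0"
        using i W_x_nz[OF _ x0(2)] by (intro continuous_intros) auto
      from mero_val_isCont[OF this]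
      show "mero_val (\<lambda>x. wronskian h i x / wronskian h (i - 1) x) x0 \<noteq> 0"
        using i W_x_nz[OF _ x0(2)] by auto
    qed
  next
    fix k x assume k: "k \<in> {1..n}"
    then obtain j where j: "k = Suc j" "j < n" by (cases k) auto
    \<comment> \<open>Off the roots of \<open>Q\<close> the relation is the defining recursion
      divided by the pivot. The roots are isolated, and \<open>mero_val\<close> depends on a
      punctured neighbourhood only.\<close>
    have "deriv (\<lambda>t. wronskian_chain h f j t / (wronskian h k t / wronskian h j t)) t
      = wronskian_chain h f k t / (wronskian h k t / wronskian h j t)" if t: "poly Q t \<noteq> 0" for t
    proof -
      have "\<forall>\<^sub>F s in nhds t. wronskian_chain h f j s / (wronskian h k s / wronskian h j s)
          = wronskian h j s / wronskian h (Suc j) s * chain_val p q n j s"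
        using eventually_nhds_poly_nonzero[OF t] by eventually_elim (use j in \<open>simp add: chain\<close>)
      from deriv_cong_ev[OF this refl] deriv_chain_val[of n h p q j t, OF h] show ?thesis
        using t j W_x_nz[of k t] W_x_nz[of j t] chain[of k t] by (simp add: Q_def field_simps)
    qed
    then have "\<forall>\<^sub>F t in at x. deriv (\<lambda>t. wronskian_chain h f j t / (wronskian h k t / wronskian h j t)) t
      = wronskian_chain h f k t / (wronskian h k t / wronskian h j t)"
      using eventually_at_poly_nonzero[OF Q] by (rule eventually_mono[rotated])
    from mero_val_cong[OF this]
    show "mero_val (deriv (\<lambda>t. wronskian_chain h f (k - 1) t / (wronskian h k t / wronskian h (k - 1) t))) x
      = mero_val (\<lambda>t. wronskian_chain h f k t / (wronskian h k t / wronskian h (k - 1) t)) x"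
      by (simp add: j)
  qed
  moreover have "\<exists>P. P \<noteq> 0 \<and> (\<forall>x. wronskian h m x = poly P x * exp (\<Sum>j=1..m. poly (q j) x))"
    if "m \<in> {1..n}" for m
    using W W_nz that by (intro exI[of _ "wronskian_poly p q m"]) simp
  ultimately show ?thesis using last_zero by (intro conjI ballI allI impI)
qed

end
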